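(* Let $n\ge1$, let $M$ be even, and let $O_1,\dots,O_M$ be $2^n\times 2^n$ Hermitian matrices such that each $O_i$ is traceless, for each $i\le M/2$ all eigenvalues of $O_i$ lie in $\{+1,-1\}$, and $O_{i+M/2}=-O_i$ for all $i=1,\dots,M/2$. Define $$\delta(O_1,\dots,O_M)=\sup_{|\phi\rangle}\frac{2}{M}\sum_{i=1}^{M/2}\langle\phi|O_i|\phi\rangle^2,$$ the supremum over all unit vectors $|\phi\rangle\in\mathbb{C}^{2^n}$. There is an absolute constant $c>0$ such that for every $0<\epsilon<1/4$ the following holds: any learning algorithm without quantum memory which, for every unknown $n$-qubit state $\rho$, outputs estimates of $\mathrm{Tr}(O_x\rho)$ that are simultaneously within additive error $\epsilon$ for all $x=1,\dots,M$ with probability at least $2/3$, must use $$T\ \ge\ \frac{c}{\epsilon^2\,\delta(O_1,\dots,O_M)}$$ copies of $\rho$.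
   Context: An $n$-qubit state is a $2^n\times 2^n$ positive semidefinite complex matrix of trace one. A learning algorithm without quantum memory using $T$ copies of an unknown $n$-qubit state $\rho$ proceeds in $T$ rounds: in each round it receives a fresh copy of $\rho$, chooses a POVM $\{F_s\}_s$ on $n$ qubits (positive semidefinite matrices with $\sum_s F_s=I$), where the choice may depend arbitrarily on all previously observed classical outcomes, and observes outcome $s$ with probability $\mathrm{Tr}(F_s\rho)$; no quantum state is retained between rounds. Its final output is an arbitrary function of the observed classical outcomes. *)

theory Defs
  imports "Jordan_Normal_Form.Jordan_Normal_Form_Existence" "HOL-Analysis.Infinite_Sum"
begin

definition trace :: "complex mat \<Rightarrow> complex" where
  "trace A = (\<Sum>i<dim_row A. A $$ (i,i))"

definition hermitian_mat :: "nat \<Rightarrow> complex mat \<Rightarrow> bool" where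
  "hermitian_mat N A \<longleftrightarrow> A \<in> carrier_mat N N \<and>
     (\<forall>i<N. \<forall>j<N. A $$ (i,j) = cnj (A $$ (j,i)))"

definition expval :: "complex mat \<Rightarrow> complex vec \<Rightarrow> complex" where
  "expval A v = (A *\<^sub>v v) \<bullet>c v"

definition unit_vec :: "nat \<Rightarrow> complex vec \<Rightarrow> bool" where
  "unit_vec N v \<longleftrightarrow> v \<in> carrier_vec N \<and> v \<bullet>c v = 1"

definition psd_mat :: "nat \<Rightarrow> complex mat \<Rightarrow> bool" where
  "psd_mat N A \<longleftrightarrow> hermitian_mat N A \<and>
     (\<forall>v \<in> carrier_vec N. Re (expval A v) \<ge> 0)"

definition quantum_state :: "nat \<Rightarrow> complex mat \<Rightarrow> bool" where
  "quantum_state n \<rho> \<longleftrightarrow> psd_mat (2^n) \<rho> \<and> trace \<rho> = 1"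

definition povm :: "nat \<Rightarrow> (nat \<Rightarrow> complex mat) \<Rightarrow> bool" where
  "povm n F \<longleftrightarrow> (\<forall>s. psd_mat (2^n) (F s)) \<and>
     (\<forall>i<2^n. \<forall>j<2^n. (\<lambda>s. F s $$ (i,j)) sums (if i = j then 1 else 0))"

text \<open>A learning algorithm without quantum memory using T copies:
  after observing the history h (list of previous outcomes, oldest first)
  it measures the fresh copy with the POVM  meas h;  finally it outputs
  out h :: nat \<Rightarrow> real (estimate for each observable index) from the full
  transcript h of length T.\<close>
record algorithm =
  meas :: "nat list \<Rightarrow> nat \<Rightarrow> complex mat"
  out  :: "nat list \<Rightarrow> nat \<Rightarrow> real"

definition valid_algorithm :: "nat \<Rightarrow> algorithm \<Rightarrow> bool" where
  "valid_algorithm n A \<longleftrightarrow> (\<forall>h. povm n (meas A h))"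

definition transcript_prob :: "algorithm \<Rightarrow> complex mat \<Rightarrow> nat list \<Rightarrow> real" where
  "transcript_prob A \<rho> h =
     (\<Prod>t<length h. Re (trace (meas A (take t h) (h ! t) * \<rho>)))"

definition success_prob ::
  "algorithm \<Rightarrow> nat \<Rightarrow> complex mat \<Rightarrow> nat \<Rightarrow> (nat \<Rightarrow> complex mat) \<Rightarrow> real \<Rightarrow> real" where
  "success_prob A T \<rho> M Obs \<epsilon> =
     infsum (\<lambda>h. if (\<forall>x\<in>{1..M}. \<bar>out A h x - Re (trace (Obs x * \<rho>))\<bar> \<le> \<epsilon>)
                 then transcript_prob A \<rho> h else 0) {h. length h = T}"

definition delta :: "nat \<Rightarrow> nat \<Rightarrow> (nat \<Rightarrow> complex mat) \<Rightarrow> real" where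
  "delta n M Obs = (SUP \<phi> \<in> {\<phi>. unit_vec (2^n) \<phi>}.
      2 / real M * (\<Sum>i=1..M div 2. (Re (expval (Obs i) \<phi>))^2))"

end

theory Submission
  imports "HOL-Analysis.Convex" "HOL-Analysis.Infinite_Products" Defs
begin

text \<open>
  Compare the maximally mixed state \<open>I/N\<close>, where \<open>N = 2^n\<close>, with the states
  \<open>(I \<plusminus> 3\<epsilon> O\<^sub>i)/N\<close>. An output that is \<open>\<epsilon>\<close>-accurate for the former is wrong for all of the latter, so the
  event \<open>G\<close> of being accurate for \<open>I/N\<close> has probability at least \<open>2/3\<close> under \<open>I/N\<close> and at most \<open>1/3\<close>
  under every perturbed state. On a transcript with measured effects \<open>F\<^sub>t\<close> the likelihood ratio
  of a perturbed state is \<open>\<Prod>(1 \<plusminus> b\<^sub>t)\<close> with \<open>b\<^sub>t = 3\<epsilon> Tr (F\<^sub>t O\<^sub>i) / Tr F\<^sub>t\<close>. Averaging over the sign and using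
  AM-GM gives at least \<open>1 - \<Sum>b\<^sub>t\<^sup>2\<close>, and averaging over \<open>i\<close> gives at least \<open>1 - 9 \<epsilon>\<^sup>2 T \<delta>\<close>, because writing
  an effect as a sum of rank-one matrices reduces the average of \<open>(Tr (F O\<^sub>i) / Tr F)\<^sup>2\<close> to unit vectors.
  Hence \<open>(1 - 9 \<epsilon>\<^sup>2 T \<delta>) 2/3 \<le> 1/3\<close>.
\<close>

subsection \<open>Positive semidefinite matrices\<close>

text \<open>Matrices and vectors are plain index functions here, so that the induction in
  \<open>psd_Gram\<close> can modify them freely; \<open>expval_vec\<close> links the form to
  \<open>expval\<close>.\<close>

definition qform :: "nat \<Rightarrow> (nat \<Rightarrow> nat \<Rightarrow> complex) \<Rightarrow> (nat \<Rightarrow> complex) \<Rightarrow> complex" where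
  "qform N F v = (\<Sum>i<N. \<Sum>j<N. F i j * v j * cnj (v i))"

text \<open>Moving a single coordinate \<open>p\<close> by \<open>c\<close> makes the form quadratic
  in \<open>c\<close>; a good choice of \<open>c\<close> then extracts what positivity says about
  row \<open>p\<close>.\<close>

lemma qform_shift:
  assumes "p < N"
  shows "qform N F (\<lambda>i. v i + (if i = p then c else 0)) =
    qform N F v + c * (\<Sum>i<N. F i p * cnj (v i)) + cnj c * (\<Sum>j<N. F p j * v j) + c * cnj c * F p p"
proof -
  have e: "F i j * (v j + (if j = p then c else 0)) * cnj (v i + (if i = p then c else 0)) =
     F i j * v j * cnj (v i) + (if j = p then c * (F i j * cnj (v i)) else 0)
     + (if i = p then cnj c * (F i j * v j) else 0)
     + (if i = p then (if j = p then c * cnj c * F i j else 0) else 0)" for i j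
    by (auto simp: algebra_simps)
  have i1: "(\<Sum>j<N. if i = p then f j else 0) = (if i = p then \<Sum>j<N. f j else (0::complex))" for i f
    by simp
  show ?thesis
    unfolding qform_def e sum.distrib i1 using assms
    by (simp add: sum.delta sum_distrib_left)
qed

text \<open>Cholesky factorisation: each step splits off the rank-one matrix of the first non-zero row.\<close>

lemma psd_Gram:
  fixes F :: "nat \<Rightarrow> nat \<Rightarrow> complex"
  assumes "m \<le> N"
    and "\<And>i j. i < N \<Longrightarrow> j < N \<Longrightarrow> F i j = cnj (F j i)"
    and "\<And>v. 0 \<le> Re (qform N F v)"
    and "\<And>i j. i < N \<Longrightarrow> j < N \<Longrightarrow> i < N - m \<Longrightarrow> F i j = 0"
  shows "\<exists>V. \<forall>i<N. \<forall>j<N. F i j = (\<Sum>k<m. V k i * cnj (V k j))"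
  using assms
proof (induction m arbitrary: F)
  case 0
  then show ?case by auto
next
  case (Suc m)
  \<comment> \<open>Rows before \<open>p\<close> vanish by the last hypothesis, so \<open>p\<close>
    is the next pivot.\<close>
  define p where "p = N - Suc m"
  have p: "p < N" using Suc.prems(1) by (auto simp: p_def)
  have lt: "i < N - m \<longleftrightarrow> i < p \<or> i = p" for i
    using Suc.prems(1) by (auto simp: p_def)
  define d where "d = Re (F p p)"
  have Fpp: "F p p = of_real d"
    using arg_cong[OF Suc.prems(2)[OF p p], of Im] by (simp add: d_def complex_eq_iff)
  have herm_p: "F j p = cnj (F p j)" if "j < N" for j
    using Suc.prems(2)[OF that p] .
  define g where "g v = (\<Sum>j<N. F p j * v j)" for v
  have g': "(\<Sum>i<N. F i p * cnj (v i)) = cnj (g v)" for v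
    unfolding g_def cnj_sum by (rule sum.cong[OF refl]) (use herm_p in simp)
  \<comment> \<open>Positivity at \<open>v\<close> shifted by \<open>c\<close> in coordinate
    \<open>p\<close>; by hermiticity the two linear terms are conjugate and merge into one real
    part.\<close>
  have shift: "0 \<le> Re (qform N F v) + 2 * Re (cnj c * g v) + (cmod c)\<^sup>2 * d" for v c
  proof -
    have "0 \<le> Re (qform N F (\<lambda>i. v i + (if i = p then c else 0)))" by (rule Suc.prems(3))
    also have "\<dots> = Re (qform N F v) + 2 * Re (cnj c * g v) + (cmod c)\<^sup>2 * d"
      unfolding qform_shift[OF p] g' unfolding g_def[symmetric] Fpp cmod_power2
      by (simp add: power2_eq_square algebra_simps)
    finally show ?thesis .
  qed
  have gj: "g (\<lambda>i. if i = j then 1 else 0) = F p j" if "j < N" for j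
    using that unfolding g_def by (simp add: if_distrib sum.delta cong: if_cong)
  show ?case
  proof (cases "d = 0")
    case True
    have g0: "g v = 0" for v
    proof (rule ccontr)
      assume "g v \<noteq> 0"
      \<comment> \<open>For \<open>d = 0\<close> the bound is affine in \<open>c\<close>; this
        \<open>t\<close> drives it to -1 along \<open>c = - t * g v\<close>. Hence \<open>g\<close>
        is zero and row \<open>p\<close> vanishes.\<close>
      define t where "t = (Re (qform N F v) + 1) / (2 * (cmod (g v))\<^sup>2)"
      have "0 \<le> Re (qform N F v) - 2 * t * (cmod (g v))\<^sup>2"
        using shift[of v "- of_real t * g v"] True unfolding cmod_power2
        by (simp add: power2_eq_square algebra_simps)
      also have "\<dots> = -1" using \<open>g v \<noteq> 0\<close> by (simp add: t_def field_simps)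
      finally show False by simp
    qed
    have F0: "F p j = 0" if "j < N" for j using gj[OF that] g0 by metis
    have "\<exists>V. \<forall>i<N. \<forall>j<N. F i j = (\<Sum>k<m. V k i * cnj (V k j))"
    proof (rule Suc.IH)
      show "F i j = 0" if "i < N" "j < N" "i < N - m" for i j
        using that Suc.prems(4)[of i j] F0 unfolding lt p_def[symmetric] by auto
    qed (fact Suc_leD[OF Suc.prems(1)], fact Suc.prems(2), fact Suc.prems(3))
    then obtain V where V: "\<And>i j. i < N \<Longrightarrow> j < N \<Longrightarrow> F i j = (\<Sum>k<m. V k i * cnj (V k j))"
      by blast
    show ?thesis
      by (rule exI[of _ "V(m := \<lambda>_. 0)"]) (simp add: V)
  next
    case False
    have d0: "d \<ge> 0" using shift[of "\<lambda>_. 0" 1] by (simp add: qform_def g_def)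
    with False have d: "d > 0" by simp
    \<comment> \<open>The Schur complement of the pivot \<open>d\<close>: row and column
      \<open>p\<close> are cleared.\<close>
    define G where "G i j = F i j - F i p * cnj (F j p) / of_real d" for i j
    have G_herm: "G i j = cnj (G j i)" if "i < N" "j < N" for i j
      by (subst G_def, subst Suc.prems(2)[OF that]) (simp add: G_def)
    have G_qform: "qform N G v = qform N F v - of_real ((cmod (g v))\<^sup>2 / d)" for v
    proof -
      have "(\<Sum>i<N. \<Sum>j<N. F i p * cnj (F j p) / of_real d * v j * cnj (v i))
        = (\<Sum>i<N. F i p * cnj (v i)) * (\<Sum>j<N. cnj (F j p) * v j) / of_real d"
        unfolding sum_product sum_divide_distrib by (simp add: algebra_simps)
      also have "(\<Sum>j<N. cnj (F j p) * v j) = g v"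
        unfolding g_def by (rule sum.cong[OF refl]) (simp add: herm_p)
      also have "(\<Sum>i<N. F i p * cnj (v i)) * g v / of_real d = of_real ((cmod (g v))\<^sup>2 / d)"
        unfolding g' using complex_norm_square[of "g v"] by (simp add: mult.commute)
      finally show ?thesis
        unfolding qform_def G_def by (simp add: algebra_simps sum_subtractf)
    qed
    have G_pos: "0 \<le> Re (qform N G v)" for v
    proof -
      \<comment> \<open>The shift \<open>c = - g v / d\<close> minimises the quadratic in
        \<open>c\<close>, and its minimum is exactly the form of \<open>G\<close> at
        \<open>v\<close>.\<close>
      have e1: "Re (cnj (- g v / of_real d) * g v) = - (cmod (g v))\<^sup>2 / d"
        unfolding cmod_power2 by (simp add: power2_eq_square add_divide_distrib diff_divide_distrib)
      have e2: "(cmod (- g v / of_real d))\<^sup>2 * d = (cmod (g v))\<^sup>2 / d"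
        using d by (simp add: norm_divide power2_eq_square)
      show ?thesis using shift[of v "- g v / of_real d"] unfolding e1 e2 by (simp add: G_qform)
    qed
    have G0: "G i j = 0" if ij: "i < N" "j < N" "i < N - m" for i j
    proof -
      consider "i < p" | "i = p" using ij(3) lt[of i] by blast
      then show ?thesis
      proof cases
        case 1
        then show ?thesis using Suc.prems(4)[of i j] Suc.prems(4)[of i p] ij p by (auto simp: p_def G_def)
      next
        case 2
        then show ?thesis using d herm_p[OF ij(2)] by (simp add: G_def Fpp)
      qed
    qed
    obtain V where V: "\<And>i j. i < N \<Longrightarrow> j < N \<Longrightarrow> G i j = (\<Sum>k<m. V k i * cnj (V k j))"
      using Suc.IH[of G, OF Suc_leD[OF Suc.prems(1)] G_herm G_pos G0] by blast
    have sq: "of_real (sqrt d) * of_real (sqrt d) = (of_real d :: complex)"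
      using d by (simp flip: of_real_mult)
    have "F i j = (\<Sum>k<m. V k i * cnj (V k j)) + (F i p / of_real (sqrt d)) * cnj (F j p / of_real (sqrt d))"
      if "i < N" "j < N" for i j
      using V[OF that] by (simp add: G_def sq diff_eq_eq)
    then show ?thesis
      by (intro exI[of _ "V(m := \<lambda>i. F i p / of_real (sqrt d))"]) simp
  qed
qed

section \<open>Traces against positive semidefinite matrices\<close>

lemma expval_vec: "A \<in> carrier_mat N N \<Longrightarrow> expval A (vec N v) = qform N (\<lambda>i j. A $$ (i,j)) v"
  unfolding expval_def qform_def
  by (simp add: scalar_prod_def sum_distrib_right atLeast0LessThan cong: sum.cong_simp)

lemma trace_mult:
  assumes "A \<in> carrier_mat N N" "B \<in> carrier_mat N N"
  shows "trace (A * B) = (\<Sum>i<N. \<Sum>j<N. A $$ (i,j) * B $$ (j,i))"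
  using assms unfolding trace_def
  by (simp add: scalar_prod_def atLeast0LessThan cong: sum.cong_simp)

lemma trace_mult_comm:
  assumes "A \<in> carrier_mat N N" "B \<in> carrier_mat N N"
  shows "trace (A * B) = trace (B * A)"
  unfolding trace_mult[OF assms] trace_mult[OF assms(2,1)]
  by (subst sum.swap) (simp add: mult.commute)

text \<open>By \<open>psd_Gram\<close>, \<open>F\<close> is a sum of rank-one matrices built from
  vectors \<open>V k\<close>, and tracing one of them against \<open>B\<close> gives an expectation.
  The order of quantifiers matters: a single family, not normalised, serves the identity and all
  observables at once.\<close>

lemma psd_mat_trace_mult:
  assumes "psd_mat N F"
  shows "\<exists>V. \<forall>B \<in> carrier_mat N N. trace (F * B) = (\<Sum>k<N. expval B (vec N (V k)))"
proof -
  have F: "F \<in> carrier_mat N N" and herm: "\<And>i j. i < N \<Longrightarrow> j < N \<Longrightarrow> F $$ (i,j) = cnj (F $$ (j,i))"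
    and pos: "\<And>v. v \<in> carrier_vec N \<Longrightarrow> Re (expval F v) \<ge> 0"
    using assms unfolding psd_mat_def hermitian_mat_def by blast+
  have pos': "0 \<le> Re (qform N (\<lambda>i j. F $$ (i,j)) v)" for v
    using pos[OF vec_carrier[of N v]] by (simp add: expval_vec[OF F])
  have "\<exists>V. \<forall>i<N. \<forall>j<N. F $$ (i,j) = (\<Sum>k<N. V k i * cnj (V k j))"
    by (rule psd_Gram[OF order_refl herm pos']) auto
  then obtain V where V: "\<And>i j. i < N \<Longrightarrow> j < N \<Longrightarrow> F $$ (i,j) = (\<Sum>k<N. V k i * cnj (V k j))"
    by blast
  have "trace (F * B) = (\<Sum>k<N. expval B (vec N (V k)))" if B: "B \<in> carrier_mat N N" for B
  proof -
    have "trace (F * B) = (\<Sum>i<N. \<Sum>j<N. \<Sum>k<N. B $$ (j,i) * V k i * cnj (V k j))"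
      unfolding trace_mult[OF F B]
      by (rule sum.cong[OF refl], rule sum.cong[OF refl])
        (simp add: V sum_distrib_right, simp add: mult_ac)
    also have "\<dots> = (\<Sum>j<N. \<Sum>i<N. \<Sum>k<N. B $$ (j,i) * V k i * cnj (V k j))"
      by (rule sum.swap)
    also have "\<dots> = (\<Sum>j<N. \<Sum>k<N. \<Sum>i<N. B $$ (j,i) * V k i * cnj (V k j))"
      by (rule sum.cong[OF refl], rule sum.swap)
    also have "\<dots> = (\<Sum>k<N. \<Sum>j<N. \<Sum>i<N. B $$ (j,i) * V k i * cnj (V k j))"
      by (rule sum.swap)
    finally show ?thesis using B by (simp add: expval_vec qform_def)
  qed
  then show ?thesis by blast
qed

lemma trace_mult_psd_nonneg:
  assumes "psd_mat N F" "psd_mat N B"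
  shows "0 \<le> Re (trace (F * B))"
proof -
  obtain V where V: "\<forall>B \<in> carrier_mat N N. trace (F * B) = (\<Sum>k<N. expval B (vec N (V k)))"
    using psd_mat_trace_mult[OF assms(1)] by blast
  have B: "B \<in> carrier_mat N N" "\<And>v. v \<in> carrier_vec N \<Longrightarrow> Re (expval B v) \<ge> 0"
    using assms(2) unfolding psd_mat_def hermitian_mat_def by blast+
  then show ?thesis using V by (simp add: sum_nonneg)
qed

subsection \<open>Hermitian involutions and perturbed states\<close>

text \<open>A product term through \<open>k\<close> survives only if i \<le> k \<le> j. Together
  with j \<le> i this leaves just the squared diagonal entries, which the identity cancels.\<close>

lemma upper_triangular_square_diag:
  fixes B :: "complex mat"
  assumes B: "B \<in> carrier_mat N N" and ut: "upper_triangular B"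
    and diag: "\<And>i. i < N \<Longrightarrow> B $$ (i,i) * B $$ (i,i) = 1"
    and ij: "i < N" "j \<le> i"
  shows "(B * B - 1\<^sub>m N) $$ (i,j) = 0"
proof -
  have j: "j < N" using ij by simp
  have z: "B $$ (i,k) * B $$ (k,j) = (if k = i \<and> i = j then 1 else 0)" if k: "k < N" for k
  proof (cases "k < i")
    case True
    then show ?thesis using upper_triangularD[OF ut, of k i] ij B by auto
  next
    case False
    show ?thesis
    proof (cases "j < k")
      case True
      then show ?thesis using upper_triangularD[OF ut, of j k] k B False by auto
    next
      case *: False
      then have "k = i" "i = j" using False ij by auto
      then show ?thesis using diag ij by simp
    qed
  qed
  have "(B * B) $$ (i,j) = (\<Sum>k<N. B $$ (i,k) * B $$ (k,j))"
    using B ij j by (simp add: scalar_prod_def atLeast0LessThan cong: sum.cong_simp)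
  also have "\<dots> = (\<Sum>k<N. if k = i \<and> i = j then 1 else 0)"
    by (rule sum.cong[OF refl]) (simp add: z)
  also have "\<dots> = (if i = j then 1 else 0)"
    using ij by (cases "i = j") simp_all
  finally show ?thesis using B ij j by simp
qed

lemma trace_similar_square:
  assumes C: "C \<in> carrier_mat N N" and P: "P \<in> carrier_mat N N" and Q: "Q \<in> carrier_mat N N"
    and QP: "Q * P = 1\<^sub>m N"
  shows "trace ((P * C * Q) * (P * C * Q)) = trace (C * C)"
proof -
  have "(P * C * Q) * (P * C * Q) = P * (C * (Q * P) * C * Q)"
    using C P Q by (simp add: assoc_mult_mat[of _ N N _ N _ N])
  also have "\<dots> = P * (C * C * Q)"
    unfolding QP using C by simp
  finally have "trace ((P * C * Q) * (P * C * Q)) = trace ((C * C * Q) * P)"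
    using trace_mult_comm[OF P, of "C * C * Q"] C Q by simp
  also have "(C * C * Q) * P = C * C * (Q * P)"
    using C P Q by (simp add: assoc_mult_mat[of _ N N _ N _ N])
  finally show ?thesis unfolding QP using C by simp
qed

text \<open>After triangularisation \<open>A\<^sup>2 - 1\<close> becomes strictly upper triangular, so the trace of its
  square vanishes; for the Hermitian matrix \<open>A\<^sup>2 - 1\<close> this trace is the squared Frobenius norm.\<close>

lemma hermitian_eigenvalues_pm1_square:
  assumes herm: "hermitian_mat N A"
    and ev: "\<And>k. eigenvalue A k \<Longrightarrow> k \<in> {1, -1}"
  shows "A * A = 1\<^sub>m N"
proof -
  have A: "A \<in> carrier_mat N N" using herm unfolding hermitian_mat_def by blast
  have Aij: "A $$ (i,j) = cnj (A $$ (j,i))" if "i < N" "j < N" for i j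
    using herm that unfolding hermitian_mat_def by blast
  obtain as where "char_poly A = (\<Prod>a\<leftarrow>as. [:- a, 1:])"
    using char_poly_factorized[OF A] by blast
  then obtain B where B: "B \<in> carrier_mat N N" and ut: "upper_triangular B" and sim: "similar_mat A B"
    using schur_decomposition_exists[OF A] by blast
  obtain P Q where wit: "similar_mat_wit A B P Q" using sim unfolding similar_mat_def by blast
  note w = similar_mat_witD2[OF A wit]
  \<comment> \<open>Similar matrices share their characteristic polynomial, so the diagonal of
    \<open>B\<close> consists of eigenvalues of \<open>A\<close>.\<close>
  have diag: "B $$ (i,i) * B $$ (i,i) = 1" if "i < N" for i
  proof -
    have "poly (char_poly A) (B $$ (i,i)) = 0"
      unfolding char_poly_similar[OF sim] char_poly_upper_triangular[OF B ut]
      using that B by (auto simp: poly_prod_list prod_list_zero_iff diag_mat_def)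
    then have "B $$ (i,i) \<in> {1, -1}"
      using ev eigenvalue_root_char_poly[OF A] by blast
    then show ?thesis by auto
  qed
  define C where "C = B * B - 1\<^sub>m N"
  define W where "W = A * A - 1\<^sub>m N"
  have C: "C \<in> carrier_mat N N" and W: "W \<in> carrier_mat N N"
    using A B by (auto simp: C_def W_def)
  have C0: "C $$ (i,j) = 0" if "i < N" "j \<le> i" for i j
    unfolding C_def by (rule upper_triangular_square_diag[OF B ut diag that])
  have "A * A = P * B * (Q * P) * B * Q"
    using w(3) w(5-7) by (simp add: assoc_mult_mat[of _ N N _ N _ N])
  also have "\<dots> = P * (B * B) * Q"
    unfolding w(2) using w(5-7) by (simp add: assoc_mult_mat[of _ N N _ N _ N])
  finally have AA: "A * A = P * (B * B) * Q" .
  have "P * C * Q = (P * (B * B) - P * 1\<^sub>m N) * Q"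
    unfolding C_def using w(5,6) by (subst mult_minus_distrib_mat[of _ N N _ N]) auto
  also have "\<dots> = P * (B * B) * Q - P * 1\<^sub>m N * Q"
    using w(5-7) by (subst minus_mult_distrib_mat[of _ N N _ _ N]) auto
  also have "\<dots> = W" unfolding W_def AA using w(1,6) by simp
  finally have WC: "W = P * C * Q" by simp
  have Wij: "W $$ (j,i) = cnj (W $$ (i,j))" if "i < N" "j < N" for i j
  proof -
    have "(A * A) $$ (j,i) = (\<Sum>k<N. A $$ (j,k) * A $$ (k,i))"
      using A that by (simp add: scalar_prod_def atLeast0LessThan cong: sum.cong_simp)
    also have "\<dots> = (\<Sum>k<N. cnj (A $$ (i,k) * A $$ (k,j)))"
    proof (rule sum.cong[OF refl])
      fix k assume "k \<in> {..<N}"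
      then have "A $$ (j,k) = cnj (A $$ (k,j))" "A $$ (k,i) = cnj (A $$ (i,k))"
        using Aij that by blast+
      then show "A $$ (j,k) * A $$ (k,i) = cnj (A $$ (i,k) * A $$ (k,j))"
        by (simp only: complex_cnj_mult mult.commute)
    qed
    also have "\<dots> = cnj ((A * A) $$ (i,j))"
      using A that by (simp add: scalar_prod_def atLeast0LessThan cong: sum.cong_simp)
    finally show ?thesis using A that by (simp add: W_def)
  qed
  have "trace (W * W) = trace (C * C)"
    unfolding WC by (rule trace_similar_square[OF C w(6,7,2)])
  also have "\<dots> = 0"
    unfolding trace_mult[OF C C]
  proof (intro sum.neutral ballI)
    fix i j assume "i \<in> {..<N}" "j \<in> {..<N}"
    then show "C $$ (i,j) * C $$ (j,i) = 0"
      using C0[of i j] C0[of j i] by (cases "j \<le> i") auto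
  qed
  finally have "0 = trace (W * W)" by simp
  also have "\<dots> = (\<Sum>i<N. \<Sum>j<N. of_real ((cmod (W $$ (i,j)))\<^sup>2))"
    unfolding trace_mult[OF W W]
    by (rule sum.cong[OF refl], rule sum.cong[OF refl]) (metis Wij complex_norm_square lessThan_iff)
  finally have "complex_of_real (\<Sum>i<N. \<Sum>j<N. (cmod (W $$ (i,j)))\<^sup>2) = 0" by simp
  then have "(\<Sum>i<N. \<Sum>j<N. (cmod (W $$ (i,j)))\<^sup>2) = 0" by (simp only: of_real_eq_0_iff)
  then have W0: "W $$ (i,j) = 0" if "i < N" "j < N" for i j
    using that by (simp add: sum_nonneg_eq_0_iff sum_nonneg)
  show ?thesis
  proof (rule eq_matI)
    fix i j assume "i < dim_row (1\<^sub>m N :: complex mat)" "j < dim_col (1\<^sub>m N :: complex mat)"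
    then show "(A * A) $$ (i,j) = 1\<^sub>m N $$ (i,j)" using W0[of i j] A by (simp add: W_def)
  qed (use A in auto)
qed

lemma cscalar_vec: "vec N v \<bullet>c vec N w = (\<Sum>i<N. v i * cnj (w i))"
  by (simp add: scalar_prod_def atLeast0LessThan cong: sum.cong_simp)

lemma cscalar_self_vec: "vec N v \<bullet>c vec N v = of_real (\<Sum>i<N. (cmod (v i))\<^sup>2)"
  unfolding cscalar_vec of_real_sum complex_norm_square ..

text \<open>A Hermitian involution preserves the norm, so the squared norms of
  \<open>v + A v\<close> and \<open>v - A v\<close> are twice the squared norm of \<open>v\<close>
  plus or minus twice the expectation. Both are nonnegative.\<close>

lemma involution_expval_le:
  assumes herm: "hermitian_mat N A" and AA: "A * A = 1\<^sub>m N"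
  shows "\<bar>Re (expval A (vec N v))\<bar> \<le> Re (vec N v \<bullet>c vec N v)"
proof -
  have A: "A \<in> carrier_mat N N" using herm unfolding hermitian_mat_def by blast
  have Aij: "A $$ (i,j) = cnj (A $$ (j,i))" if "i < N" "j < N" for i j
    using herm that unfolding hermitian_mat_def by blast
  define u where "u i = (\<Sum>j<N. A $$ (i,j) * v j)" for i
  have q: "expval A (vec N v) = (\<Sum>i<N. u i * cnj (v i))"
    unfolding expval_vec[OF A] qform_def u_def by (simp add: sum_distrib_right)
  have Au: "(\<Sum>j<N. A $$ (i,j) * u j) = v i" if "i < N" for i
  proof -
    have "(\<Sum>j<N. A $$ (i,j) * u j) = (\<Sum>j<N. \<Sum>k<N. A $$ (i,j) * A $$ (j,k) * v k)"
      unfolding u_def by (simp add: sum_distrib_left mult.assoc)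
    also have "\<dots> = (\<Sum>k<N. \<Sum>j<N. A $$ (i,j) * A $$ (j,k) * v k)" by (rule sum.swap)
    also have "\<dots> = (\<Sum>k<N. (A * A) $$ (i,k) * v k)"
      using A that by (simp add: scalar_prod_def atLeast0LessThan sum_distrib_right cong: sum.cong_simp)
    also have "\<dots> = (\<Sum>k<N. if k = i then v k else 0)"
      unfolding AA using that by (intro sum.cong[OF refl]) simp
    also have "\<dots> = v i" using that by simp
    finally show ?thesis .
  qed
  have "(\<Sum>i<N. u i * cnj (u i)) = (\<Sum>i<N. \<Sum>j<N. A $$ (i,j) * v j * cnj (u i))"
    by (subst u_def) (simp add: sum_distrib_right)
  also have "\<dots> = (\<Sum>j<N. \<Sum>i<N. A $$ (i,j) * v j * cnj (u i))" by (rule sum.swap)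
  also have "\<dots> = (\<Sum>j<N. v j * cnj (\<Sum>i<N. A $$ (j,i) * u i))"
    unfolding cnj_sum sum_distrib_left
    by (rule sum.cong[OF refl], rule sum.cong[OF refl]) (simp add: Aij[symmetric] mult_ac)
  also have "\<dots> = (\<Sum>j<N. v j * cnj (v j))"
    by (rule sum.cong[OF refl]) (simp add: Au)
  finally have "(\<Sum>i<N. complex_of_real ((cmod (u i))\<^sup>2)) = (\<Sum>i<N. complex_of_real ((cmod (v i))\<^sup>2))"
    by (simp only: complex_norm_square)
  then have uv: "(\<Sum>i<N. (cmod (u i))\<^sup>2) = (\<Sum>i<N. (cmod (v i))\<^sup>2)"
    by (simp only: of_real_sum[symmetric] of_real_eq_iff)
  have e: "(cmod (v i + of_real s * u i))\<^sup>2 = (cmod (v i))\<^sup>2 + 2 * s * Re (u i * cnj (v i)) + s\<^sup>2 * (cmod (u i))\<^sup>2"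
    for i and s :: real
    unfolding cmod_power2 by (simp add: power2_eq_square algebra_simps)
  have "0 \<le> (\<Sum>i<N. (cmod (v i + of_real s * u i))\<^sup>2)" for s :: real by (intro sum_nonneg) simp
  then have "0 \<le> (\<Sum>i<N. (cmod (v i))\<^sup>2) + 2 * s * Re (expval A (vec N v)) + s\<^sup>2 * (\<Sum>i<N. (cmod (v i))\<^sup>2)"
    for s :: real
    unfolding e sum.distrib q Re_sum by (simp add: sum_distrib_left[symmetric] uv)
  from this[of 1] this[of "-1"] show ?thesis
    unfolding cscalar_self_vec by simp
qed

section \<open>Perturbations of the maximally mixed state\<close>

definition perturbed_state :: "nat \<Rightarrow> real \<Rightarrow> complex mat \<Rightarrow> complex mat" where
  "perturbed_state N s A = mat N N (\<lambda>(i,j). ((if i = j then 1 else 0) + of_real s * A $$ (i,j)) / of_nat N)"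

lemma perturbed_state_carrier [simp]: "perturbed_state N s A \<in> carrier_mat N N"
  by (simp add: perturbed_state_def)

lemma trace_mult_perturbed_state:
  assumes F: "F \<in> carrier_mat N N" and A: "A \<in> carrier_mat N N"
  shows "trace (F * perturbed_state N s A) = (trace F + of_real s * trace (F * A)) / of_nat N"
proof -
  have "F $$ (i,j) * perturbed_state N s A $$ (j,i) =
      ((if j = i then F $$ (i,j) else 0) + of_real s * (F $$ (i,j) * A $$ (j,i))) / of_nat N"
    if "i < N" "j < N" for i j
    using that by (simp add: perturbed_state_def algebra_simps)
  then have "trace (F * perturbed_state N s A) = (\<Sum>i<N. \<Sum>j<N.
      ((if j = i then F $$ (i,j) else 0) + of_real s * (F $$ (i,j) * A $$ (j,i))) / of_nat N)"
    unfolding trace_mult[OF F perturbed_state_carrier] by (simp cong: sum.cong_simp)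
  also have "\<dots> = ((\<Sum>i<N. F $$ (i,i)) + of_real s * trace (F * A)) / of_nat N"
    unfolding trace_mult[OF F A]
    by (simp add: sum.distrib sum_divide_distrib[symmetric] sum_distrib_left[symmetric] sum.delta
        cong: sum.cong_simp)
  finally show ?thesis using F by (simp add: trace_def)
qed

text \<open>Positivity holds because the expectation of \<open>A\<close> is dominated by the squared
  norm and |s| \<le> 1; the trace stays 1 because \<open>A\<close> is traceless.\<close>

lemma quantum_state_perturbed_state:
  assumes herm: "hermitian_mat (2^n) A" and AA: "A * A = 1\<^sub>m (2^n)" and tr: "trace A = 0"
    and s: "\<bar>s\<bar> \<le> 1"
  shows "quantum_state n (perturbed_state (2^n) s A)"
proof -
  define N :: nat where "N = 2^n"
  have N: "N > 0" by (simp add: N_def)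
  have A: "A \<in> carrier_mat N N" using herm unfolding hermitian_mat_def N_def by blast
  have Aij: "A $$ (j,i) = cnj (A $$ (i,j))" if "i < N" "j < N" for i j
    using herm that unfolding hermitian_mat_def N_def by blast
  let ?R = "perturbed_state N s A"
  have "hermitian_mat N ?R"
    unfolding hermitian_mat_def
  proof (intro conjI allI impI)
    fix i j assume ij: "i < N" "j < N"
    show "?R $$ (i,j) = cnj (?R $$ (j,i))"
      using ij Aij[OF ij] by (simp add: perturbed_state_def)
  qed simp
  moreover have "Re (expval ?R v) \<ge> 0" if v: "v \<in> carrier_vec N" for v
  proof -
    define f where "f = vec_index v"
    have v: "v = vec N f" using v by (auto simp: f_def)
    have "?R $$ (i,j) * f j * cnj (f i) =
        ((if j = i then f i * cnj (f i) else 0) + of_real s * (A $$ (i,j) * f j * cnj (f i))) / of_nat N"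
      if "i < N" "j < N" for i j
      using that by (simp add: perturbed_state_def algebra_simps)
    then have "expval ?R v = (\<Sum>i<N. \<Sum>j<N.
        ((if j = i then f i * cnj (f i) else 0) + of_real s * (A $$ (i,j) * f j * cnj (f i))) / of_nat N)"
      unfolding v expval_vec[OF perturbed_state_carrier] qform_def by (simp cong: sum.cong_simp)
    also have "\<dots> = (v \<bullet>c v + of_real s * expval A v) / of_nat N"
      unfolding v expval_vec[OF A] qform_def cscalar_vec
      by (simp add: sum.distrib sum_divide_distrib[symmetric] sum_distrib_left[symmetric] sum.delta
        cong: sum.cong_simp)
    finally have "Re (expval ?R v) = (Re (v \<bullet>c v) + s * Re (expval A v)) / N"
      by simp
    moreover have "\<bar>s * Re (expval A v)\<bar> \<le> 1 * Re (v \<bullet>c v)"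
      unfolding abs_mult using involution_expval_le[of N A f] herm AA s
      by (intro mult_mono) (auto simp: N_def v)
    ultimately show ?thesis by (simp add: zero_le_divide_iff abs_le_iff)
  qed
  moreover have "trace ?R = 1"
  proof -
    have "trace ?R = trace (1\<^sub>m N * ?R)"
      by (simp add: left_mult_one_mat[OF perturbed_state_carrier])
    also have "\<dots> = (trace (1\<^sub>m N) + of_real s * trace (1\<^sub>m N * A)) / of_nat N"
      by (rule trace_mult_perturbed_state[OF _ A]) simp
    also have "\<dots> = 1" using N tr A by (simp add: trace_def)
    finally show ?thesis .
  qed
  ultimately show ?thesis unfolding quantum_state_def psd_mat_def N_def by blast
qed

text \<open>The identity part contributes nothing, and \<open>A * A\<close> has trace
  \<open>N\<close>, which cancels the normalisation: the signal equals the strength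
  \<open>s\<close>.\<close>

lemma trace_mult_involution_perturbed_state:
  assumes "A \<in> carrier_mat N N" "A * A = 1\<^sub>m N" "trace A = 0" "N > 0"
  shows "trace (A * perturbed_state N s A) = of_real s"
  using assms by (simp add: trace_mult_perturbed_state) (simp add: trace_def)

subsection \<open>The quantity \<open>\<delta>\<close>\<close>

lemma unit_vec_expval_bound:
  assumes "hermitian_mat N A" "A * A = 1\<^sub>m N" "unit_vec N \<phi>"
  shows "(Re (expval A \<phi>))\<^sup>2 \<le> 1"
proof -
  have "\<phi> = vec N (vec_index \<phi>)" using assms(3) by (auto simp: unit_vec_def)
  then have "\<bar>Re (expval A \<phi>)\<bar> \<le> 1"
    using involution_expval_le[OF assms(1,2), of "vec_index \<phi>"] assms(3) by (simp add: unit_vec_def)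
  then show ?thesis by (simp add: abs_square_le_1)
qed

lemma delta_ge:
  assumes "\<And>i. i \<in> {1..M div 2} \<Longrightarrow> hermitian_mat (2^n) (Obs i)"
    and "\<And>i. i \<in> {1..M div 2} \<Longrightarrow> Obs i * Obs i = 1\<^sub>m (2^n)"
    and \<phi>: "unit_vec (2^n) \<phi>"
  shows "2 / real M * (\<Sum>i=1..M div 2. (Re (expval (Obs i) \<phi>))\<^sup>2) \<le> delta n M Obs"
  unfolding delta_def
proof (rule cSUP_upper)
  \<comment> \<open>A real \<open>SUP\<close> is an upper bound only for a bounded set; here every
    square is at most 1.\<close>
  show "bdd_above ((\<lambda>\<phi>. 2 / real M * (\<Sum>i=1..M div 2. (Re (expval (Obs i) \<phi>))\<^sup>2)) ` {\<phi>. unit_vec (2^n) \<phi>})"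
  proof (rule bdd_aboveI2)
    fix \<psi> assume "\<psi> \<in> {\<phi>. unit_vec (2^n) \<phi>}"
    then have "(Re (expval (Obs i) \<psi>))\<^sup>2 \<le> 1" if "i \<in> {1..M div 2}" for i
      using assms(1,2)[OF that] by (intro unit_vec_expval_bound) auto
    then show "2 / real M * (\<Sum>i=1..M div 2. (Re (expval (Obs i) \<psi>))\<^sup>2) \<le> 2 / real M * (\<Sum>i=1..M div 2. 1)"
      by (intro mult_left_mono sum_mono) auto
  qed
qed (use \<phi> in simp)

text \<open>Homogeneous form of \<open>delta_ge\<close>: normalising \<open>v\<close> divides each
  squared expectation by the square of \<open>r\<close>, and the factor \<open>M / 2\<close> undoes
  the averaging in \<open>delta\<close>.\<close>

lemma sum_expval_le_delta:
  assumes M: "M > 0" "even M"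
    and "\<And>i. i \<in> {1..M div 2} \<Longrightarrow> hermitian_mat (2^n) (Obs i)"
    and "\<And>i. i \<in> {1..M div 2} \<Longrightarrow> Obs i * Obs i = 1\<^sub>m (2^n)"
  shows "(\<Sum>i=1..M div 2. (Re (expval (Obs i) (vec (2^n) v)))\<^sup>2)
    \<le> real M / 2 * delta n M Obs * (Re (vec (2^n) v \<bullet>c vec (2^n) v))\<^sup>2"
proof -
  define N :: nat where "N = 2^n"
  define r where "r = Re (vec N v \<bullet>c vec N v)"
  have r: "vec N v \<bullet>c vec N v = of_real r" "r \<ge> 0"
    unfolding r_def cscalar_self_vec by (auto intro: sum_nonneg)
  show ?thesis
  proof (cases "r = 0")
    case True
    \<comment> \<open>The zero vector cannot be normalised, but \<open>involution_expval_le\<close>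
      forces its expectations to vanish.\<close>
    have "Re (expval (Obs i) (vec N v)) = 0" if "i \<in> {1..M div 2}" for i
      using involution_expval_le[of N "Obs i" v] assms that True by (simp add: r_def N_def)
    then show ?thesis using True unfolding N_def[symmetric] by (simp add: r_def)
  next
    case False
    with r have r0: "r > 0" by simp
    define c where "c = complex_of_real (1 / sqrt r)"
    have cc: "c * cnj c = of_real (1 / r)"
      using r0 by (simp add: c_def flip: of_real_mult)
    define w where "w = (\<lambda>i. c * v i)"
    have "vec N w \<bullet>c vec N w = c * cnj c * (vec N v \<bullet>c vec N v)"
      unfolding w_def cscalar_vec sum_distrib_left by (rule sum.cong) auto
    then have u: "unit_vec N (vec N w)" using r0 by (simp add: unit_vec_def cc r)
    have e: "expval A (vec N w) = c * cnj c * expval A (vec N v)" if "A \<in> carrier_mat N N" for A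
      unfolding expval_vec[OF that] qform_def w_def sum_distrib_left
      by (intro sum.cong[OF refl]) simp
    have e': "(Re (expval (Obs i) (vec N w)))\<^sup>2 = (Re (expval (Obs i) (vec N v)))\<^sup>2 / r\<^sup>2"
      if "i \<in> {1..M div 2}" for i
    proof -
      have "Obs i \<in> carrier_mat N N" using assms(3)[OF that] unfolding N_def hermitian_mat_def by blast
      from e[OF this] show ?thesis by (simp add: cc power_divide)
    qed
    have "2 / real M * (\<Sum>i=1..M div 2. (Re (expval (Obs i) (vec N w)))\<^sup>2) \<le> delta n M Obs"
      using delta_ge[of M n Obs "vec N w"] assms u by (simp add: N_def)
    also have "(\<Sum>i=1..M div 2. (Re (expval (Obs i) (vec N w)))\<^sup>2)
       = (\<Sum>i=1..M div 2. (Re (expval (Obs i) (vec N v)))\<^sup>2) / r\<^sup>2"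
      unfolding sum_divide_distrib by (rule sum.cong[OF refl e'])
    finally show ?thesis
      using M r0 unfolding N_def[symmetric] r_def[symmetric] by (simp add: field_simps)
  qed
qed

text \<open>This passes from unit vectors to arbitrary POVM effects. After the rank-one
  decomposition, Cauchy-Schwarz with the squared norms \<open>r k\<close> as weights reduces the sum
  of squares to the bound for each single vector.\<close>

lemma sum_trace_le_delta:
  assumes M: "M > 0" "even M"
    and herm: "\<And>i. i \<in> {1..M div 2} \<Longrightarrow> hermitian_mat (2^n) (Obs i)"
    and inv: "\<And>i. i \<in> {1..M div 2} \<Longrightarrow> Obs i * Obs i = 1\<^sub>m (2^n)"
    and F: "psd_mat (2^n) F"
  shows "(\<Sum>i=1..M div 2. (Re (trace (F * Obs i)))\<^sup>2) \<le> real M / 2 * delta n M Obs * (Re (trace F))\<^sup>2"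
    and "i \<in> {1..M div 2} \<Longrightarrow> \<bar>Re (trace (F * Obs i))\<bar> \<le> Re (trace F)"
proof -
  define N :: nat where "N = 2^n"
  define K where "K = real M / 2 * delta n M Obs"
  obtain V where V: "\<forall>B \<in> carrier_mat N N. trace (F * B) = (\<Sum>k<N. expval B (vec N (V k)))"
    using psd_mat_trace_mult[OF F] unfolding N_def by blast
  have Oc: "Obs i \<in> carrier_mat N N" if "i \<in> {1..M div 2}" for i
    using herm[OF that] unfolding hermitian_mat_def N_def by blast
  have Fc: "F \<in> carrier_mat N N"
    using F unfolding psd_mat_def hermitian_mat_def N_def by blast
  define r where "r k = Re (vec N (V k) \<bullet>c vec N (V k))" for k
  define e where "e i k = Re (expval (Obs i) (vec N (V k)))" for i k
  have "trace F = trace (F * 1\<^sub>m N)" using Fc by simp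
  also have "\<dots> = (\<Sum>k<N. expval (1\<^sub>m N) (vec N (V k)))" using V by simp
  finally have trF: "Re (trace F) = (\<Sum>k<N. r k)" by (simp add: expval_def r_def)
  have trO: "Re (trace (F * Obs i)) = (\<Sum>k<N. e i k)" if "i \<in> {1..M div 2}" for i
    using V Oc[OF that] by (simp add: e_def)
  have r0: "r k \<ge> 0" for k unfolding r_def cscalar_self_vec by (auto intro: sum_nonneg)
  have er: "\<bar>e i k\<bar> \<le> r k" if "i \<in> {1..M div 2}" for i k
    unfolding e_def r_def N_def by (rule involution_expval_le[OF herm[OF that] inv[OF that]])
  show "\<bar>Re (trace (F * Obs i))\<bar> \<le> Re (trace F)" if "i \<in> {1..M div 2}"
    unfolding trO[OF that] trF using er[OF that] by (intro order_trans[OF sum_abs] sum_mono)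
  have sume: "(\<Sum>i=1..M div 2. (e i k)\<^sup>2) \<le> K * (r k)\<^sup>2" for k
    unfolding e_def r_def N_def K_def by (rule sum_expval_le_delta[OF M herm inv])
  have cs: "(\<Sum>k<N. e i k)\<^sup>2 \<le> (\<Sum>k<N. r k) * (\<Sum>k<N. (e i k)\<^sup>2 / r k)" if i: "i \<in> {1..M div 2}" for i
  proof -
    \<comment> \<open>If \<open>r k = 0\<close> then \<open>e i k = 0\<close> by \<open>er\<close>,
      so division by zero does no harm.\<close>
    have "e i k = sqrt (r k) * (e i k / sqrt (r k))" for k
      using er[OF i, of k] by (cases "r k = 0") auto
    then have "(\<Sum>k<N. e i k)\<^sup>2 = (\<Sum>k<N. sqrt (r k) * (e i k / sqrt (r k)))\<^sup>2" by simp
    also have "\<dots> \<le> (\<Sum>k<N. (sqrt (r k))\<^sup>2) * (\<Sum>k<N. (e i k / sqrt (r k))\<^sup>2)"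
      by (rule Cauchy_Schwarz_ineq_sum)
    finally show ?thesis using r0 by (simp add: power_divide)
  qed
  have "(\<Sum>i=1..M div 2. (Re (trace (F * Obs i)))\<^sup>2) = (\<Sum>i=1..M div 2. (\<Sum>k<N. e i k)\<^sup>2)"
    by (rule sum.cong) (use trO in auto)
  also have "\<dots> \<le> (\<Sum>i=1..M div 2. (\<Sum>k<N. r k) * (\<Sum>k<N. (e i k)\<^sup>2 / r k))"
    by (rule sum_mono[OF cs])
  also have "\<dots> = (\<Sum>k<N. r k) * (\<Sum>i=1..M div 2. \<Sum>k<N. (e i k)\<^sup>2 / r k)"
    by (rule sum_distrib_left[symmetric])
  also have "(\<Sum>i=1..M div 2. \<Sum>k<N. (e i k)\<^sup>2 / r k) = (\<Sum>k<N. \<Sum>i=1..M div 2. (e i k)\<^sup>2 / r k)"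
    by (rule sum.swap)
  also have "(\<Sum>k<N. r k) * \<dots> \<le> (\<Sum>k<N. r k) * (\<Sum>k<N. K * r k)"
  proof (intro mult_left_mono sum_mono sum_nonneg r0)
    fix k
    show "(\<Sum>i=1..M div 2. (e i k)\<^sup>2 / r k) \<le> K * r k"
      using sume[of k] r0[of k] unfolding sum_divide_distrib[symmetric]
      by (cases "r k = 0") (auto simp: divide_le_eq power2_eq_square mult.assoc)
  qed
  also have "\<dots> = K * (Re (trace F))\<^sup>2"
    unfolding trF sum_distrib_left[symmetric] by (simp add: power2_eq_square)
  finally show "(\<Sum>i=1..M div 2. (Re (trace (F * Obs i)))\<^sup>2) \<le> real M / 2 * delta n M Obs * (Re (trace F))\<^sup>2"
    unfolding K_def .
qed

subsection \<open>Transcript distributions\<close>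

text \<open>By AM-GM the mean of the two products is at least \<open>sqrt (\<Prod>(1 - b\<^sup>2))\<close>, hence at least
  \<open>\<Prod>(1 - b\<^sup>2)\<close>.\<close>

lemma prod_pm_ge:
  fixes b :: "'a \<Rightarrow> real"
  assumes "\<And>t. t \<in> I \<Longrightarrow> \<bar>b t\<bar> \<le> 1"
  shows "2 * (1 - (\<Sum>t\<in>I. (b t)\<^sup>2)) \<le> (\<Prod>t\<in>I. 1 + b t) + (\<Prod>t\<in>I. 1 - b t)"
proof -
  define X where "X = (\<Prod>t\<in>I. 1 + b t)"
  define Y where "Y = (\<Prod>t\<in>I. 1 - b t)"
  have b: "-1 \<le> b t" "b t \<le> 1" "(b t)\<^sup>2 \<le> 1" if "t \<in> I" for t
    using assms[OF that] by (auto simp: abs_le_iff abs_square_le_1)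
  have X: "X \<ge> 0" and Y: "Y \<ge> 0"
    unfolding X_def Y_def using b by (force intro!: prod_nonneg)+
  have XY: "X * Y = (\<Prod>t\<in>I. 1 - (b t)\<^sup>2)"
    unfolding X_def Y_def prod.distrib[symmetric] by (simp add: power2_eq_square algebra_simps)
  have le1: "X * Y \<le> 1" unfolding XY by (rule prod_le_1) (use b in auto)
  \<comment> \<open>AM-GM without a square root: since X Y \<le> 1, the square of 2 X Y is at most 4
    X Y.\<close>
  have "(2 * (X * Y))\<^sup>2 = 4 * ((X * Y) * (X * Y))" by (simp add: power2_eq_square)
  also have "\<dots> \<le> 4 * ((X * Y) * 1)"
    using X Y le1 by (intro mult_left_mono) auto
  also have "\<dots> \<le> (X + Y)\<^sup>2"
    using zero_le_power2[of "X - Y"] by (simp add: power2_eq_square algebra_simps)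
  finally have AM_GM: "2 * (X * Y) \<le> X + Y" by (rule power2_le_imp_le) (use X Y in simp)
  have "2 * (1 - (\<Sum>t\<in>I. (b t)\<^sup>2)) \<le> 2 * (X * Y)"
    unfolding XY by (intro mult_left_mono Weierstrass_prod_ineq) (use b in auto)
  also note AM_GM
  finally show ?thesis unfolding X_def Y_def .
qed

text \<open>The trace involves finitely many entries, so entrywise convergence to the identity makes
  the full series sum to \<open>trace \<rho> = 1\<close>; its terms are nonnegative.\<close>

lemma povm_partial_sum_le_1:
  assumes F: "povm n F" and \<rho>: "quantum_state n \<rho>"
  shows "(\<Sum>s<K. Re (trace (F s * \<rho>))) \<le> 1"
proof -
  define N :: nat where "N = 2^n"
  have \<rho>c: "psd_mat N \<rho>" "\<rho> \<in> carrier_mat N N" "trace \<rho> = 1"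
    using \<rho> unfolding quantum_state_def psd_mat_def hermitian_mat_def N_def by blast+
  have Fc: "psd_mat N (F s)" "F s \<in> carrier_mat N N" for s
    using F unfolding povm_def psd_mat_def hermitian_mat_def N_def by blast+
  have ent: "(\<lambda>s. F s $$ (i,j)) sums (if i = j then 1 else 0)" if "i < N" "j < N" for i j
    using F that unfolding povm_def N_def by blast
  have "(\<lambda>s. \<Sum>i<N. \<Sum>j<N. F s $$ (i,j) * \<rho> $$ (j,i)) sums
        (\<Sum>i<N. \<Sum>j<N. (if i = j then 1 else 0) * \<rho> $$ (j,i))"
    by (intro sums_sum sums_mult2 ent) auto
  also have "(\<Sum>i<N. \<Sum>j<N. (if i = j then 1 else 0) * \<rho> $$ (j,i)) = (\<Sum>i<N. \<Sum>j<N. if j = i then \<rho> $$ (j,i) else 0)"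
    by (intro sum.cong) auto
  also have "\<dots> = trace \<rho>" using \<rho>c(2) by (simp add: trace_def)
  finally have "(\<lambda>s. trace (F s * \<rho>)) sums 1"
    unfolding trace_mult[OF Fc(2) \<rho>c(2)] \<rho>c(3) .
  from sums_Re[OF this] have s: "(\<lambda>s. Re (trace (F s * \<rho>))) sums 1" by simp
  have "(\<Sum>s<K. Re (trace (F s * \<rho>))) \<le> (\<Sum>s. Re (trace (F s * \<rho>)))"
    using s by (intro sum_le_suminf) (auto simp: sums_iff intro: trace_mult_psd_nonneg[OF Fc(1) \<rho>c(1)])
  then show ?thesis using s by (simp add: sums_iff)
qed

lemma transcript_prob_nonneg:
  assumes "valid_algorithm n A" "quantum_state n \<rho>"
  shows "0 \<le> transcript_prob A \<rho> h"
  unfolding transcript_prob_def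
proof (intro prod_nonneg)
  fix t
  have "psd_mat (2^n) (meas A (take t h) (h ! t))" "psd_mat (2^n) \<rho>"
    using assms unfolding valid_algorithm_def povm_def quantum_state_def by blast+
  then show "0 \<le> Re (trace (meas A (take t h) (h ! t) * \<rho>))" by (rule trace_mult_psd_nonneg)
qed

lemma transcript_prob_snoc:
  "transcript_prob A \<rho> (h @ [s]) = transcript_prob A \<rho> h * Re (trace (meas A h s * \<rho>))"
  unfolding transcript_prob_def by (simp add: nth_append)

text \<open>Induction peels off the last outcome, whose conditional probabilities sum to at most 1.
  Bounding outcomes by \<open>K\<close> keeps the set of transcripts finite.\<close>

lemma sum_transcript_prob_bounded_le_1:
  assumes A: "valid_algorithm n A" and \<rho>: "quantum_state n \<rho>"
  shows "(\<Sum>h | set h \<subseteq> {..<K} \<and> length h = T. transcript_prob A \<rho> h) \<le> 1"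
proof (induction T)
  case 0
  have "{h. set h \<subseteq> {..<K} \<and> length h = 0} = {[]}" by auto
  then show ?case by (simp add: transcript_prob_def)
next
  case (Suc T)
  let ?L = "\<lambda>T. {h. set h \<subseteq> {..<K} \<and> length h = T}"
  have fin: "finite (?L T)" by (rule finite_lists_length_eq) simp
  have img: "?L (Suc T) = (\<lambda>(h,s). h @ [s]) ` (?L T \<times> {..<K})"
  proof (intro equalityI subsetI)
    fix h assume h: "h \<in> ?L (Suc T)"
    then have "h \<noteq> []" by auto
    then obtain h' s where "h = h' @ [s]" by (metis rev_exhaust)
    with h show "h \<in> (\<lambda>(h,s). h @ [s]) ` (?L T \<times> {..<K})" by (auto intro!: image_eqI[of _ _ "(h', s)"])
  qed auto
  have "(\<Sum>h\<in>?L (Suc T). transcript_prob A \<rho> h) = (\<Sum>(h,s)\<in>?L T \<times> {..<K}. transcript_prob A \<rho> (h @ [s]))"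
    unfolding img by (subst sum.reindex) (auto simp: inj_on_def case_prod_beta)
  also have "\<dots> = (\<Sum>h\<in>?L T. transcript_prob A \<rho> h * (\<Sum>s<K. Re (trace (meas A h s * \<rho>))))"
    by (simp add: sum.cartesian_product[symmetric] transcript_prob_snoc sum_distrib_left)
  also have "\<dots> \<le> (\<Sum>h\<in>?L T. transcript_prob A \<rho> h * 1)"
  proof (intro sum_mono mult_left_mono)
    fix h
    have "povm n (meas A h)" using A unfolding valid_algorithm_def by blast
    then show "(\<Sum>s<K. Re (trace (meas A h s * \<rho>))) \<le> 1" using \<rho> by (rule povm_partial_sum_le_1)
  qed (rule transcript_prob_nonneg[OF A \<rho>])
  finally show ?case using Suc.IH by simp
qed

lemma sum_transcript_prob_le_1:
  assumes A: "valid_algorithm n A" and \<rho>: "quantum_state n \<rho>"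
    and S: "finite S" "S \<subseteq> {h. length h = T}"
  shows "(\<Sum>h\<in>S. transcript_prob A \<rho> h) \<le> 1"
proof -
  \<comment> \<open>Finitely many transcripts use finitely many outcomes. Adding 0 keeps
    \<open>Max\<close> meaningful when no outcome occurs, and \<open>Suc\<close> makes the bound
    strict.\<close>
  define K where "K = Suc (Max (\<Union>(set ` S) \<union> {0}))"
  have "set h \<subseteq> {..<K}" if "h \<in> S" for h
  proof
    fix x assume "x \<in> set h"
    then have "x \<le> Max (\<Union>(set ` S) \<union> {0})" using that S(1) by (intro Max_ge) auto
    then show "x \<in> {..<K}" by (simp add: K_def)
  qed
  then have "(\<Sum>h\<in>S. transcript_prob A \<rho> h) \<le> (\<Sum>h | set h \<subseteq> {..<K} \<and> length h = T. transcript_prob A \<rho> h)"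
    using S transcript_prob_nonneg[OF A \<rho>] by (intro sum_mono2 finite_lists_length_eq) auto
  also have "\<dots> \<le> 1" by (rule sum_transcript_prob_bounded_le_1[OF A \<rho>])
  finally show ?thesis .
qed

section \<open>From success probabilities to the lower bound\<close>

lemma infsum_le_of_finite_sums:
  fixes f :: "'a \<Rightarrow> real"
  assumes "\<And>S. finite S \<Longrightarrow> S \<subseteq> U \<Longrightarrow> sum f S \<le> b"
  shows "infsum f U \<le> b"
proof (cases "f summable_on U")
  case True
  then show ?thesis using assms by (rule infsum_le_finite_sums)
next
  case False
  \<comment> \<open>Without summability \<open>infsum\<close> is 0 by default, and the empty sum
    shows that 0 \<le> \<open>b\<close>.\<close>
  then show ?thesis using assms[of "{}"] by (simp add: infsum_not_exists)
qed

text \<open>Transcripts in \<open>S\<close> are failures for \<open>\<rho>\<close>, hence disjoint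
  from the success event; of total mass at most 1, success already takes 2/3.\<close>

lemma transcript_prob_disjoint_success:
  assumes A: "valid_algorithm n A" and \<rho>: "quantum_state n \<rho>"
    and succ: "success_prob A T \<rho> M Obs \<epsilon> \<ge> 2/3"
    and S: "finite S" "S \<subseteq> {h. length h = T}"
    and disj: "\<And>h. h \<in> S \<Longrightarrow> \<exists>x\<in>{1..M}. \<not> \<bar>out A h x - Re (trace (Obs x * \<rho>))\<bar> \<le> \<epsilon>"
  shows "(\<Sum>h\<in>S. transcript_prob A \<rho> h) \<le> 1/3"
proof -
  let ?g = "\<lambda>h. \<forall>x\<in>{1..M}. \<bar>out A h x - Re (trace (Obs x * \<rho>))\<bar> \<le> \<epsilon>"
  have "success_prob A T \<rho> M Obs \<epsilon> \<le> 1 - (\<Sum>h\<in>S. transcript_prob A \<rho> h)"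
    unfolding success_prob_def
  proof (rule infsum_le_of_finite_sums)
    fix R :: "nat list set" assume R: "finite R" "R \<subseteq> {h. length h = T}"
    have "(\<Sum>h\<in>R. if ?g h then transcript_prob A \<rho> h else 0) = (\<Sum>h\<in>{h\<in>R. ?g h}. transcript_prob A \<rho> h)"
      using R(1) by (simp add: sum.If_cases Int_def)
    moreover have "(\<Sum>h\<in>{h\<in>R. ?g h}. transcript_prob A \<rho> h) + (\<Sum>h\<in>S. transcript_prob A \<rho> h)
        = (\<Sum>h\<in>{h\<in>R. ?g h} \<union> S. transcript_prob A \<rho> h)"
      using R(1) S(1) disj by (intro sum.union_disjoint[symmetric]) auto
    moreover have "\<dots> \<le> 1"
      using R S by (intro sum_transcript_prob_le_1[OF A \<rho>, of _ T]) auto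
    ultimately show "(\<Sum>h\<in>R. if ?g h then transcript_prob A \<rho> h else 0) \<le> 1 - (\<Sum>h\<in>S. transcript_prob A \<rho> h)"
      by linarith
  qed
  with succ show ?thesis by linarith
qed

text \<open>Where \<open>Tr F = 0\<close> the outcome has probability zero under every state, which is consistent with
  the ratio \<open>Tr (F O) / Tr F\<close> being \<open>0\<close> there.\<close>

lemma transcript_prob_mixture_ge:
  assumes M: "M > 0" "even M"
    and herm: "\<And>i. i \<in> {1..M div 2} \<Longrightarrow> hermitian_mat (2^n) (Obs i)"
    and inv: "\<And>i. i \<in> {1..M div 2} \<Longrightarrow> Obs i * Obs i = 1\<^sub>m (2^n)"
    and A: "valid_algorithm n A" and s: "\<bar>s\<bar> \<le> 1" and d: "delta n M Obs \<ge> 0"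
  shows "real M * (1 - s\<^sup>2 * real (length h) * delta n M Obs) * transcript_prob A (perturbed_state (2^n) 0 B) h
    \<le> (\<Sum>i=1..M div 2. transcript_prob A (perturbed_state (2^n) s (Obs i)) h
        + transcript_prob A (perturbed_state (2^n) (-s) (Obs i)) h)"
proof -
  define N :: nat where "N = 2^n"
  define I where "I = {..<length h}"
  define F where "F t = meas A (take t h) (h ! t)" for t
  define f where "f t = Re (trace (F t))" for t
  define g where "g t i = Re (trace (F t * Obs i))" for t i
  define \<delta> where "\<delta> = delta n M Obs"
  have F: "psd_mat (2^n) (F t)" for t
    using A unfolding F_def valid_algorithm_def povm_def by blast
  have Fc: "F t \<in> carrier_mat N N" for t
    using F unfolding psd_mat_def hermitian_mat_def N_def by blast
  have Oc: "Obs i \<in> carrier_mat N N" if "i \<in> {1..M div 2}" for i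
    using herm[OF that] unfolding hermitian_mat_def N_def by blast
  have gf: "\<bar>g t i\<bar> \<le> f t" if "i \<in> {1..M div 2}" for t i
    unfolding g_def f_def by (rule sum_trace_le_delta(2)[OF M]) (use herm inv F that in blast)+
  have sumg: "(\<Sum>i=1..M div 2. (g t i / f t)\<^sup>2) \<le> real M / 2 * \<delta>" for t
  proof (cases "f t = 0")
    case True
    then show ?thesis using d by (simp add: \<delta>_def)
  next
    case False
    have "(\<Sum>i=1..M div 2. (g t i)\<^sup>2) \<le> real M / 2 * \<delta> * (f t)\<^sup>2"
      unfolding g_def f_def \<delta>_def by (rule sum_trace_le_delta(1)[OF M]) (use herm inv F in blast)+
    then show ?thesis
      using False unfolding power_divide sum_divide_distrib[symmetric] by (simp add: divide_le_eq)
  qed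
  \<comment> \<open>The probability under the maximally mixed state factors out, leaving the
    likelihood ratio.\<close>
  have tp: "transcript_prob A (perturbed_state N r (Obs i)) h = (\<Prod>t\<in>I. f t / N) * (\<Prod>t\<in>I. 1 + r * (g t i / f t))"
    if i: "i \<in> {1..M div 2}" for r i
    unfolding transcript_prob_def F_def[symmetric] I_def prod.distrib[symmetric]
  proof (rule prod.cong[OF refl])
    fix t
    have "Re (trace (F t * perturbed_state N r (Obs i))) = (f t + r * g t i) / N"
      by (simp add: trace_mult_perturbed_state[OF Fc Oc[OF i]] f_def g_def)
    moreover have "f t * (1 + r * (g t i / f t)) = f t + r * g t i"
      using gf[OF i, of t] by (cases "f t = 0") (auto simp: field_simps)
    ultimately show "Re (trace (F t * perturbed_state N r (Obs i))) = f t / N * (1 + r * (g t i / f t))"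
      by simp
  qed
  have tp0: "transcript_prob A (perturbed_state N 0 B) h = (\<Prod>t\<in>I. f t / N)"
  proof -
    \<comment> \<open>At strength 0 the matrix \<open>B\<close> is multiplied by 0, so one of known
      dimension can replace it.\<close>
    have "perturbed_state N 0 B = perturbed_state N 0 (0\<^sub>m N N)"
      by (simp add: perturbed_state_def)
    then show ?thesis
      unfolding transcript_prob_def F_def[symmetric] I_def
      by (simp add: trace_mult_perturbed_state[OF Fc] f_def)
  qed
  have P: "0 \<le> (\<Prod>t\<in>I. f t / N)"
  proof (intro prod_nonneg)
    fix t
    \<comment> \<open>Some observable exists since \<open>M\<close> is positive and even;
      \<open>gf\<close> for it forces \<open>f t\<close> to be nonnegative.\<close>
    have "1 \<in> {1..M div 2}" using M by (auto elim: evenE)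
    from gf[OF this, of t] show "0 \<le> f t / N" by simp
  qed
  have pair: "2 * (1 - (\<Sum>t\<in>I. s\<^sup>2 * (g t i / f t)\<^sup>2))
      \<le> (\<Prod>t\<in>I. 1 + s * (g t i / f t)) + (\<Prod>t\<in>I. 1 + (-s) * (g t i / f t))"
    if i: "i \<in> {1..M div 2}" for i
  proof -
    have "\<bar>g t i / f t\<bar> \<le> 1" for t
      using gf[OF i, of t] by (cases "f t = 0") (auto simp: divide_le_eq_1)
    then have "\<bar>s * (g t i / f t)\<bar> \<le> 1" for t
      unfolding abs_mult using s by (intro mult_le_one) auto
    from prod_pm_ge[of I "\<lambda>t. s * (g t i / f t)", OF this]
    show ?thesis by (simp add: power_mult_distrib power_divide)
  qed
  have K: "real (card {1..M div 2}) = real M / 2" using M(2) by (auto elim: evenE)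
  \<comment> \<open>Exchanging the sums lets \<open>sumg\<close> act round by round, so the loss
    grows only linearly in the number of rounds, despite adaptivity.\<close>
  have "(\<Sum>i=1..M div 2. \<Sum>t\<in>I. s\<^sup>2 * (g t i / f t)\<^sup>2) = (\<Sum>t\<in>I. s\<^sup>2 * (\<Sum>i=1..M div 2. (g t i / f t)\<^sup>2))"
    unfolding sum_distrib_left by (rule sum.swap)
  also have "\<dots> \<le> (\<Sum>t\<in>I. s\<^sup>2 * (real M / 2 * \<delta>))"
    by (intro sum_mono mult_left_mono sumg) simp
  also have "\<dots> = real M / 2 * (s\<^sup>2 * real (length h) * \<delta>)" by (simp add: I_def)
  finally have "real M * (1 - s\<^sup>2 * real (length h) * \<delta>)
      \<le> 2 * (real (card {1..M div 2}) - (\<Sum>i=1..M div 2. \<Sum>t\<in>I. s\<^sup>2 * (g t i / f t)\<^sup>2))"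
    unfolding K by (simp add: algebra_simps)
  also have "\<dots> = (\<Sum>i=1..M div 2. 2 * (1 - (\<Sum>t\<in>I. s\<^sup>2 * (g t i / f t)\<^sup>2)))"
    unfolding sum_distrib_left[symmetric] sum_subtractf by simp
  also have "\<dots> \<le> (\<Sum>i=1..M div 2. (\<Prod>t\<in>I. 1 + s * (g t i / f t)) + (\<Prod>t\<in>I. 1 + (-s) * (g t i / f t)))"
    by (rule sum_mono[OF pair])
  finally have "real M * (1 - s\<^sup>2 * real (length h) * \<delta>) * (\<Prod>t\<in>I. f t / N)
      \<le> (\<Sum>i=1..M div 2. (\<Prod>t\<in>I. 1 + s * (g t i / f t)) + (\<Prod>t\<in>I. 1 + (-s) * (g t i / f t))) * (\<Prod>t\<in>I. f t / N)"
    using P by (rule mult_right_mono)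
  also have "\<dots> = (\<Sum>i=1..M div 2. transcript_prob A (perturbed_state N s (Obs i)) h
        + transcript_prob A (perturbed_state N (-s) (Obs i)) h)"
    unfolding sum_distrib_right
    by (rule sum.cong[OF refl]) (simp only: tp distrib_left mult.commute)
  finally show ?thesis unfolding \<delta>_def tp0[unfolded N_def] N_def .
qed

text \<open>The threshold 1/2 is where \<open>1 / (3 * (1 - \<kappa>))\<close>, the bound on the
  accuracy probability under the maximally mixed state, reaches the required 2/3.\<close>

lemma copies_lower_bound:
  assumes M: "M > 0" "even M"
    and herm: "\<And>i. i \<in> {1..M div 2} \<Longrightarrow> hermitian_mat (2^n) (Obs i)"
    and inv: "\<And>i. i \<in> {1..M div 2} \<Longrightarrow> Obs i * Obs i = 1\<^sub>m (2^n)"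
    and traceless: "\<And>i. i \<in> {1..M} \<Longrightarrow> trace (Obs i) = 0"
    and carrier: "\<And>i. i \<in> {1..M} \<Longrightarrow> Obs i \<in> carrier_mat (2^n) (2^n)"
    and \<epsilon>: "0 < \<epsilon>" "\<epsilon> < 1/4" and A: "valid_algorithm n A"
    and succ: "\<And>\<rho>. quantum_state n \<rho> \<Longrightarrow> success_prob A T \<rho> M Obs \<epsilon> \<ge> 2/3"
    and d: "delta n M Obs \<ge> 0"
  shows "1/2 \<le> 9 * \<epsilon>\<^sup>2 * real T * delta n M Obs"
proof (rule ccontr)
  define N :: nat where "N = 2^n"
  define \<kappa> where "\<kappa> = 9 * \<epsilon>\<^sup>2 * real T * delta n M Obs"
  assume "\<not> ?thesis"
  then have \<kappa>: "\<kappa> < 1/2" by (simp add: \<kappa>_def)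
  have half: "i \<in> {1..M}" if "i \<in> {1..M div 2}" for i using that by auto
  have one: "1 \<in> {1..M div 2}" using M by (auto elim: evenE)
  define \<rho>0 where "\<rho>0 = perturbed_state N 0 (Obs 1)"
  have qs: "quantum_state n (perturbed_state N r (Obs i))" if "i \<in> {1..M div 2}" "\<bar>r\<bar> \<le> 1" for r i
    unfolding N_def using herm inv traceless half that by (intro quantum_state_perturbed_state) auto
  \<comment> \<open>Thus accuracy for \<open>\<rho>0\<close> just means that all outputs have
    modulus at most \<epsilon>.\<close>
  have tr0: "trace (Obs x * \<rho>0) = 0" if "x \<in> {1..M}" for x
    using that carrier[OF that] carrier[OF half[OF one]] traceless
    unfolding \<rho>0_def N_def by (simp add: trace_mult_perturbed_state)
  \<comment> \<open>The strength 3\<epsilon> is below 1, so these are states; and an output of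
    modulus at most \<epsilon> misses the true value 3\<epsilon> or -3\<epsilon> by at least
    2\<epsilon>.\<close>
  have small: "(\<Sum>h\<in>S. transcript_prob A (perturbed_state N r (Obs i)) h) \<le> 1/3"
    if i: "i \<in> {1..M div 2}" and r: "r = 3 * \<epsilon> \<or> r = - (3 * \<epsilon>)"
      and S: "finite S" "S \<subseteq> {h. length h = T}" "\<And>h. h \<in> S \<Longrightarrow> \<forall>x\<in>{1..M}. \<bar>out A h x\<bar> \<le> \<epsilon>" for i r S
  proof (rule transcript_prob_disjoint_success[OF A _ _ S(1,2)])
    show q: "quantum_state n (perturbed_state N r (Obs i))"
      using r \<epsilon> by (intro qs i) auto
    show "2/3 \<le> success_prob A T (perturbed_state N r (Obs i)) M Obs \<epsilon>" by (rule succ[OF q])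
    fix h assume "h \<in> S"
    then have "\<bar>out A h i\<bar> \<le> \<epsilon>" using S(3) half[OF i] by blast
    moreover have "trace (Obs i * perturbed_state N r (Obs i)) = of_real r"
      using carrier[OF half[OF i]] inv[OF i] traceless[OF half[OF i]]
      unfolding N_def by (intro trace_mult_involution_perturbed_state) auto
    ultimately have "\<not> \<bar>out A h i - Re (trace (Obs i * perturbed_state N r (Obs i)))\<bar> \<le> \<epsilon>"
      using r \<epsilon> by auto
    then show "\<exists>x\<in>{1..M}. \<not> \<bar>out A h x - Re (trace (Obs x * perturbed_state N r (Obs i)))\<bar> \<le> \<epsilon>"
      using half[OF i] by blast
  qed
  have bound: "(\<Sum>h\<in>S. transcript_prob A \<rho>0 h) \<le> 1 / (3 * (1 - \<kappa>))"
    if S: "finite S" "S \<subseteq> {h. length h = T}" "\<And>h. h \<in> S \<Longrightarrow> \<forall>x\<in>{1..M}. \<bar>out A h x\<bar> \<le> \<epsilon>" for S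
  proof -
    have "real M * (1 - \<kappa>) * (\<Sum>h\<in>S. transcript_prob A \<rho>0 h)
        = (\<Sum>h\<in>S. real M * (1 - (3 * \<epsilon>)\<^sup>2 * real (length h) * delta n M Obs) * transcript_prob A \<rho>0 h)"
      unfolding sum_distrib_left using S(2)
      by (intro sum.cong) (auto simp: \<kappa>_def power_mult_distrib)
    also have "\<dots> \<le> (\<Sum>h\<in>S. \<Sum>i=1..M div 2. transcript_prob A (perturbed_state N (3 * \<epsilon>) (Obs i)) h
        + transcript_prob A (perturbed_state N (- (3 * \<epsilon>)) (Obs i)) h)"
      unfolding \<rho>0_def N_def using \<epsilon>
      by (intro sum_mono transcript_prob_mixture_ge[OF M herm inv A _ d]) auto
    also have "\<dots> = (\<Sum>i=1..M div 2. (\<Sum>h\<in>S. transcript_prob A (perturbed_state N (3 * \<epsilon>) (Obs i)) h)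
        + (\<Sum>h\<in>S. transcript_prob A (perturbed_state N (- (3 * \<epsilon>)) (Obs i)) h))"
      unfolding sum.distrib[symmetric] by (rule sum.swap)
    \<comment> \<open>Each of the \<open>M / 2\<close> observables contributes both signs, each of
      mass at most 1/3.\<close>
    also have "\<dots> \<le> (\<Sum>i=1..M div 2. 1/3 + 1/3)"
      by (intro sum_mono add_mono small S) auto
    also have "\<dots> = real M / 3" using M(2) by (auto elim: evenE)
    finally have "real M * ((1 - \<kappa>) * (\<Sum>h\<in>S. transcript_prob A \<rho>0 h)) \<le> real M * (1/3)"
      by (simp add: mult.assoc)
    then have "(1 - \<kappa>) * (\<Sum>h\<in>S. transcript_prob A \<rho>0 h) \<le> 1/3"
      by (rule mult_left_le_imp_le) (use M(1) in simp)
    then show ?thesis using \<kappa> by (simp add: field_simps)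
  qed
  have "success_prob A T \<rho>0 M Obs \<epsilon> \<le> 1 / (3 * (1 - \<kappa>))"
    unfolding success_prob_def
  proof (rule infsum_le_of_finite_sums)
    let ?g = "\<lambda>h. \<forall>x\<in>{1..M}. \<bar>out A h x - Re (trace (Obs x * \<rho>0))\<bar> \<le> \<epsilon>"
    fix R :: "nat list set" assume R: "finite R" "R \<subseteq> {h. length h = T}"
    have "(\<Sum>h\<in>R. if ?g h then transcript_prob A \<rho>0 h else 0) = (\<Sum>h\<in>{h\<in>R. ?g h}. transcript_prob A \<rho>0 h)"
      using R(1) by (simp add: sum.If_cases Int_def)
    also have "\<dots> \<le> 1 / (3 * (1 - \<kappa>))"
      using R tr0 by (intro bound) auto
    finally show "(\<Sum>h\<in>R. if ?g h then transcript_prob A \<rho>0 h else 0) \<le> 1 / (3 * (1 - \<kappa>))" .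
  qed
  moreover have "2/3 \<le> success_prob A T \<rho>0 M Obs \<epsilon>"
    unfolding \<rho>0_def by (intro succ qs one) simp
  moreover have "1 / (3 * (1 - \<kappa>)) < 2/3" using \<kappa> by (simp add: field_simps)
  ultimately show False by linarith
qed

theorem mainTheorem1:
  shows "\<exists>c::real > 0. \<forall>n::nat. \<forall>M::nat. \<forall>Obs::nat \<Rightarrow> complex mat. \<forall>\<epsilon>::real.
    \<forall>A::algorithm. \<forall>T::nat.
      n \<ge> 1 \<longrightarrow> M > 0 \<longrightarrow> even M \<longrightarrow>
      (\<forall>i\<in>{1..M}. hermitian_mat (2^n) (Obs i) \<and> trace (Obs i) = 0) \<longrightarrow>
      (\<forall>i\<in>{1..M div 2}. \<forall>k. eigenvalue (Obs i) k \<longrightarrow> k \<in> {1, -1}) \<longrightarrow>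
      (\<forall>i\<in>{1..M div 2}. Obs (i + M div 2) = - Obs i) \<longrightarrow>
      0 < \<epsilon> \<longrightarrow> \<epsilon> < 1/4 \<longrightarrow>
      valid_algorithm n A \<longrightarrow>
      (\<forall>\<rho>. quantum_state n \<rho> \<longrightarrow> success_prob A T \<rho> M Obs \<epsilon> \<ge> 2/3) \<longrightarrow>
      real T \<ge> c / (\<epsilon>^2 * delta n M Obs)"
proof (intro exI[of _ "1/18 :: real"] conjI allI impI)
  fix n M :: nat and Obs :: "nat \<Rightarrow> complex mat" and \<epsilon> :: real and A :: algorithm and T :: nat
  assume M: "M > 0" "even M"
    and Obs: "\<forall>i\<in>{1..M}. hermitian_mat (2^n) (Obs i) \<and> trace (Obs i) = 0"
    and ev: "\<forall>i\<in>{1..M div 2}. \<forall>k. eigenvalue (Obs i) k \<longrightarrow> k \<in> {1, -1}"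
    and \<epsilon>: "0 < \<epsilon>" "\<epsilon> < 1/4" and A: "valid_algorithm n A"
    and succ: "\<forall>\<rho>. quantum_state n \<rho> \<longrightarrow> success_prob A T \<rho> M Obs \<epsilon> \<ge> 2/3"
  \<comment> \<open>The constant is the threshold 1/2 divided by the factor 9 from the squared
    strength 3\<epsilon>.\<close>
  show "1/18 / (\<epsilon>\<^sup>2 * delta n M Obs) \<le> real T"
  proof (cases "delta n M Obs > 0")
    case True
    have herm: "hermitian_mat (2^n) (Obs i)" if "i \<in> {1..M div 2}" for i
    proof -
      have "i \<in> {1..M}" using that by auto
      then show ?thesis using Obs by blast
    qed
    have "1/2 \<le> 9 * \<epsilon>\<^sup>2 * real T * delta n M Obs"
    proof (rule copies_lower_bound[OF M herm])
      show "Obs i * Obs i = 1\<^sub>m (2^n)" if "i \<in> {1..M div 2}" for i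
        using hermitian_eigenvalues_pm1_square[OF herm[OF that]] ev that by blast
      show "trace (Obs i) = 0" if "i \<in> {1..M}" for i using Obs that by blast
      show "Obs i \<in> carrier_mat (2^n) (2^n)" if "i \<in> {1..M}" for i
        using Obs that unfolding hermitian_mat_def by blast
    qed (use \<epsilon> A succ True in auto)
    then show ?thesis using True \<epsilon> by (simp add: field_simps)
  next
    case False
    \<comment> \<open>If \<open>delta\<close> is not positive the bound is trivial; at
      \<open>delta = 0\<close> division by zero yields 0.\<close>
    then have "1/18 / (\<epsilon>\<^sup>2 * delta n M Obs) \<le> 0"
      by (simp add: divide_le_0_iff mult_le_0_iff)
    then show ?thesis by (rule order_trans) simp
  qed
qed simp

end
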